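(* Let $k,t$ be coprime positive integers with $3\le k<t$, let $G(k,t)$ be the corresponding distance graph, and let $S=(2,2,2,\ldots)$ be the infinite constant sequence all of whose terms equal $2$. Then $\chi_S(G(k,t))=5$ if either (i) $t\equiv 1$ or $4 \pmod 5$ and $k\equiv 2$ or $3\pmod 5$, or (ii) $t\equiv 2$ or $3\pmod 5$ and $k\equiv 1$ or $4\pmod 5$; and $\chi_S(G(k,t))=6$ otherwise.
   Context: For positive integers $k<t$, the distance graph $G(k,t)=G(\mathbb{Z},\{k,t\})$ is the infinite graph with vertex set $\mathbb{Z}$ in which $x,y\in\mathbb{Z}$ are adjacent if and only if $|x-y|\in\{k,t\}$. Let $G$ be a graph and $S=(s_1,s_2,\ldots)$ a non-decreasing sequence of positive integers. For a positive integer $\ell$, an $S$-packing $\ell$-coloring of $G$ is a map $f:V(G)\to\{1,\ldots,\ell\}$ such that for every $i\in\{1,\ldots,\ell\}$ and any two distinct vertices $u,v$ with $f(u)=f(v)=i$, the (shortest-path) distance between $u$ and $v$ in $G$ is greater than $s_i$. The $S$-packing chromatic number $\chi_S(G)$ is the smallest $\ell$ such that $G$ has an $S$-packing $\ell$-coloring. *)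

theory Defs
  imports Main "HOL-Library.Extended_Nat"
begin

text \<open>
  A graph is given by its adjacency relation, its vertices being all elements of the type.
  For a simple graph it is symmetric and irreflexive; the definitions do not enforce this.
\<close>

definition distance_graph :: "int set \<Rightarrow> int \<Rightarrow> int \<Rightarrow> bool" where
  "distance_graph D x y \<longleftrightarrow> \<bar>x - y\<bar> \<in> D"

definition G :: "nat \<Rightarrow> nat \<Rightarrow> int \<Rightarrow> int \<Rightarrow> bool" where
  "G k t = distance_graph {int k, int t}"

lemma G_symp: "symp (G k t)"
  by (auto simp: symp_def G_def distance_graph_def abs_minus_commute)

lemma G_irreflp: "0 < k \<Longrightarrow> 0 < t \<Longrightarrow> irreflp (G k t)"
  by (auto simp: irreflp_def G_def distance_graph_def)

text \<open>
  \<open>(E ^^ n) u v\<close> holds iff there is a walk of length \<open>n\<close> from \<open>u\<close> to \<open>v\<close>. The distance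
  between vertices in different components is \<open>\<infinity>\<close>, as \<open>Inf {} = \<infinity>\<close> in \<^typ>\<open>enat\<close>.
\<close>

definition graph_dist :: "('a \<Rightarrow> 'a \<Rightarrow> bool) \<Rightarrow> 'a \<Rightarrow> 'a \<Rightarrow> enat" where
  "graph_dist E u v = Inf {enat n | n. (E ^^ n) u v}"

text \<open>
  A sequence \<open>S = (s\<^sub>1, s\<^sub>2, \<dots>)\<close> is a function on \<^typ>\<open>nat\<close> whose value at 0 is irrelevant.
\<close>

definition packing_sequence :: "(nat \<Rightarrow> nat) \<Rightarrow> bool" where
  "packing_sequence S \<longleftrightarrow> (\<forall>i\<ge>1. 0 < S i) \<and> mono_on {1..} S"

definition packing_coloring ::
    "(nat \<Rightarrow> nat) \<Rightarrow> nat \<Rightarrow> ('a \<Rightarrow> 'a \<Rightarrow> bool) \<Rightarrow> ('a \<Rightarrow> nat) \<Rightarrow> bool" where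
  "packing_coloring S l E f \<longleftrightarrow>
     (\<forall>v. f v \<in> {1..l}) \<and>
     (\<forall>i\<in>{1..l}. \<forall>u v. u \<noteq> v \<and> f u = i \<and> f v = i \<longrightarrow> enat (S i) < graph_dist E u v)"

text \<open>The value is \<open>\<infinity>\<close> if there is no \<open>S\<close>-packing coloring with finitely many colors.\<close>

definition packing_chromatic_number ::
    "(nat \<Rightarrow> nat) \<Rightarrow> ('a \<Rightarrow> 'a \<Rightarrow> bool) \<Rightarrow> enat" where
  "packing_chromatic_number S E = Inf {enat l | l. 1 \<le> l \<and> (\<exists>f. packing_coloring S l E f)}"

definition S2 :: "nat \<Rightarrow> nat" where
  "S2 = (\<lambda>_. 2)"

lemma packing_sequence_S2: "packing_sequence S2"
  by (simp add: packing_sequence_def S2_def mono_on_def)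

end

theory Submission
  imports Defs
begin

text \<open>
  Two vertices of \<open>G k t\<close> are at distance at most 2 iff their difference is, up to sign, one of
  \<open>0, k, t, 2 * k, 2 * t, k + t, k - t\<close>. A vertex and its four neighbors need five colors. With
  exactly five colors, every such star sees every color, so the color of \<open>p + k + t\<close> is that of
  \<open>p - k\<close> or that of \<open>p - t\<close>. The choice propagates to the neighbors of \<open>p\<close> and hence, \<open>k\<close> and \<open>t\<close>
  being coprime, to all of \<open>\<int>\<close>. So the coloring has the periods \<open>2 * k + t\<close> and \<open>k - 2 * t\<close> (or
  the same with \<open>k\<close> and \<open>t\<close> exchanged), which forces \<open>5 dvd 2 * k + t\<close> (or \<open>5 dvd 2 * t + k\<close>);
  conversely \<open>x mod 5\<close> is then a coloring.

  For six colors, concatenate blocks \<open>01234\<close> and \<open>012345\<close> to a cyclic word of length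
  \<open>N = 2 * t + k\<close> (or \<open>N = 2 * k + t\<close>) in which equal letters are at distance at least 5, and
  read it along \<open>x \<mapsto> c * x mod N\<close> for a suitable multiplier \<open>c\<close>. Neither length is a sum of fives
  and sixes only for \<open>(k, t) = (4, 5)\<close> and \<open>(k, t) = (3, 8)\<close>, which have periodic colorings modulo
  6 and 12.
\<close>

section \<open>Forbidden differences and distance at most two\<close>

definition separated :: "int \<Rightarrow> int \<Rightarrow> (int \<Rightarrow> 'a) \<Rightarrow> bool" where
  "separated k t f \<longleftrightarrow> (\<forall>p. \<forall>d\<in>{k, t, 2*k, 2*t, k + t, k - t}. f (p + d) \<noteq> f p)"

lemma separatedD:
  assumes "separated k t f" "d \<in> {k, t, 2*k, 2*t, k + t, k - t}" "\<bar>x - y\<bar> = \<bar>d\<bar>"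
  shows "f x \<noteq> f y"
proof -
  have "x = y + d \<or> y = x + d" using assms(3) by linarith
  then show ?thesis using assms(1,2) unfolding separated_def by metis
qed

text \<open>Exchanging \<open>k\<close> and \<open>t\<close> only turns \<open>k - t\<close> into
  its negative, and the sign of a difference is immaterial because \<open>p\<close> ranges over all
  integers.\<close>

lemma separated_commute: "separated k t f \<longleftrightarrow> separated t k f"
proof -
  have "separated t k f" if "separated k t f" for k t
    unfolding separated_def
  proof (intro allI ballI)
    fix p d assume "d \<in> {t, k, 2*t, 2*k, t + k, t - k}"
    then have "d \<in> {k, t, 2*k, 2*t, k + t, k - t} \<or> -d \<in> {k, t, 2*k, 2*t, k + t, k - t}" by auto
    then show "f (p + d) \<noteq> f p"
      using separatedD[OF that, of d "p + d" p] separatedD[OF that, of "-d" "p + d" p] by auto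
  qed
  then show ?thesis by blast
qed

lemma two_less_graph_dist_iff:
  "enat 2 < graph_dist E u v \<longleftrightarrow> u \<noteq> v \<and> \<not> E u v \<and> \<not> (\<exists>w. E u w \<and> E w v)"
proof -
  have rel: "(E ^^ 0) u v \<longleftrightarrow> u = v" "(E ^^ 1) u v \<longleftrightarrow> E u v"
    "(E ^^ 2) u v \<longleftrightarrow> (\<exists>w. E u w \<and> E w v)"
    by (auto simp: numeral_2_eq_2 OO_def)
  have "enat 2 < graph_dist E u v \<longleftrightarrow> (\<forall>n. (E ^^ n) u v \<longrightarrow> 2 < n)"
  proof
    assume "enat 2 < graph_dist E u v"
    then show "\<forall>n. (E ^^ n) u v \<longrightarrow> 2 < n"
      unfolding graph_dist_def
      by (metis (mono_tags, lifting) Inf_lower enat_ord_simps(2) mem_Collect_eq order_less_le_trans)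
  next
    assume *: "\<forall>n. (E ^^ n) u v \<longrightarrow> 2 < n"
    \<comment> \<open>The bound on the infimum also covers unreachable pairs, where the set of walk
      lengths is empty.\<close>
    have "enat 3 \<le> graph_dist E u v"
      unfolding graph_dist_def by (rule Inf_greatest) (use * in force)
    then show "enat 2 < graph_dist E u v"
      by (rule less_le_trans[rotated]) simp
  qed
  also have "\<dots> \<longleftrightarrow> (\<forall>n\<le>2. \<not> (E ^^ n) u v)"
    by (meson not_less)
  also have "\<dots> \<longleftrightarrow> \<not> (E ^^ 0) u v \<and> \<not> (E ^^ 1) u v \<and> \<not> (E ^^ 2) u v"
    by (auto simp: numeral_2_eq_2 le_Suc_eq)
  finally show ?thesis using rel by blast
qed

lemma two_less_graph_dist_G:
  fixes k t :: nat
  assumes "u \<noteq> v"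
  shows "enat 2 < graph_dist (G k t) u v \<longleftrightarrow>
    (\<forall>d\<in>{int k, int t, 2 * int k, 2 * int t, int k + int t, int k - int t}. \<bar>u - v\<bar> \<noteq> \<bar>d\<bar>)"
    (is "_ \<longleftrightarrow> ?R")
proof -
  let ?k = "int k" and ?t = "int t"
  have "(\<exists>w. G k t u w \<and> G k t w v) \<longleftrightarrow>
      \<bar>u - v\<bar> = 2 * ?k \<or> \<bar>u - v\<bar> = 2 * ?t \<or> \<bar>u - v\<bar> = ?k + ?t \<or> \<bar>u - v\<bar> = \<bar>?k - ?t\<bar>"
    (is "?L \<longleftrightarrow> ?M")
  proof
    assume ?L
    then obtain w where "\<bar>u - w\<bar> = ?k \<or> \<bar>u - w\<bar> = ?t" "\<bar>w - v\<bar> = ?k \<or> \<bar>w - v\<bar> = ?t"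
      by (auto simp: G_def distance_graph_def)
    with assms show ?M by arith
  next
    assume ?M
    then consider "\<bar>u - v\<bar> = 2 * ?k" | "\<bar>u - v\<bar> = 2 * ?t" | "\<bar>u - v\<bar> = ?k + ?t"
      | "\<bar>u - v\<bar> = \<bar>?k - ?t\<bar>" by blast
    \<comment> \<open>The middle vertex is one step of \<open>k\<close> (of \<open>t\<close> in case
      2) away from \<open>u\<close>; one of the two directions fits, depending on the sign of
      \<open>u - v\<close>.\<close>
    then obtain w where "\<bar>u - w\<bar> = ?k \<or> \<bar>u - w\<bar> = ?t" "\<bar>w - v\<bar> = ?k \<or> \<bar>w - v\<bar> = ?t"
    proof cases
      case 1
      then have "\<bar>u - (u - ?k)\<bar> = ?k \<and> \<bar>(u - ?k) - v\<bar> = ?k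
        \<or> \<bar>u - (u + ?k)\<bar> = ?k \<and> \<bar>(u + ?k) - v\<bar> = ?k" by linarith
      then show thesis using that by blast
    next
      case 2
      then have "\<bar>u - (u - ?t)\<bar> = ?t \<and> \<bar>(u - ?t) - v\<bar> = ?t
        \<or> \<bar>u - (u + ?t)\<bar> = ?t \<and> \<bar>(u + ?t) - v\<bar> = ?t" by linarith
      then show thesis using that by blast
    next
      case 3
      then have "\<bar>u - (u - ?k)\<bar> = ?k \<and> \<bar>(u - ?k) - v\<bar> = ?t
        \<or> \<bar>u - (u + ?k)\<bar> = ?k \<and> \<bar>(u + ?k) - v\<bar> = ?t" by linarith
      then show thesis using that by blast
    next
      case 4
      then have "\<bar>u - (u - ?k)\<bar> = ?k \<and> \<bar>(u - ?k) - v\<bar> = ?t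
        \<or> \<bar>u - (u + ?k)\<bar> = ?k \<and> \<bar>(u + ?k) - v\<bar> = ?t" by linarith
      then show thesis using that by blast
    qed
    then show ?L by (auto simp: G_def distance_graph_def)
  qed
  then show ?thesis
    using assms by (auto simp: two_less_graph_dist_iff G_def distance_graph_def)
qed

lemma packing_coloring_S2_G_iff:
  assumes "0 < k" "k < t"
  shows "packing_coloring S2 l (G k t) f \<longleftrightarrow> range f \<subseteq> {1..l} \<and> separated (int k) (int t) f"
proof -
  let ?D = "{int k, int t, 2 * int k, 2 * int t, int k + int t, int k - int t}"
  have "(\<forall>i\<in>{1..l}. \<forall>u v. u \<noteq> v \<and> f u = i \<and> f v = i \<longrightarrow> enat (S2 i) < graph_dist (G k t) u v)
      \<longleftrightarrow> separated (int k) (int t) f" (is "?L \<longleftrightarrow> ?R") if "\<forall>v. f v \<in> {1..l}"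
  proof
    assume L: ?L
    show ?R unfolding separated_def
    proof (intro allI ballI notI)
      fix p d assume d: "d \<in> ?D" and eq: "f (p + d) = f p"
      \<comment> \<open>\<open>k < t\<close> is what keeps the difference \<open>k - t\<close> from
        being 0.\<close>
      have "p + d \<noteq> p" using d assms by auto
      with L eq that have "enat 2 < graph_dist (G k t) (p + d) p" unfolding S2_def by blast
      with two_less_graph_dist_G[OF \<open>p + d \<noteq> p\<close>] d show False by fastforce
    qed
  next
    assume R: ?R
    show ?L unfolding S2_def
    proof (intro ballI allI impI, elim conjE)
      fix i u v assume uv: "u \<noteq> v" "f u = i" "f v = i"
      have "\<forall>d\<in>?D. \<bar>u - v\<bar> \<noteq> \<bar>d\<bar>"
      proof (intro ballI notI)
        fix d assume "d \<in> ?D" "\<bar>u - v\<bar> = \<bar>d\<bar>"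
        then have "f u \<noteq> f v" by (rule separatedD[OF R])
        then show False using uv by simp
      qed
      then show "enat 2 < graph_dist (G k t) u v"
        by (rule iffD2[OF two_less_graph_dist_G[OF uv(1)]])
    qed
  qed
  then show ?thesis unfolding packing_coloring_def by blast
qed

section \<open>Rigidity of colorings with five colors\<close>

lemma card_star:
  fixes f :: "int \<Rightarrow> 'a"
  assumes "separated k t f"
  shows "card {f p, f (p + k), f (p - k), f (p + t), f (p - t)} = 5"
proof -
  note s = separatedD[OF assms]
  have "f (p + k) \<noteq> f p" "f (p - k) \<noteq> f p" "f (p + t) \<noteq> f p" "f (p - t) \<noteq> f p"
    "f (p + k) \<noteq> f (p - k)" "f (p + k) \<noteq> f (p + t)" "f (p + k) \<noteq> f (p - t)"
    "f (p - k) \<noteq> f (p + t)" "f (p - k) \<noteq> f (p - t)" "f (p + t) \<noteq> f (p - t)"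
    using s[of k "p + k" p] s[of k "p - k" p] s[of t "p + t" p] s[of t "p - t" p]
      s[of "2*k" "p + k" "p - k"] s[of "k - t" "p + k" "p + t"] s[of "k + t" "p + k" "p - t"]
      s[of "k + t" "p - k" "p + t"] s[of "k - t" "p - k" "p - t"] s[of "2*t" "p + t" "p - t"]
    by simp_all
  then show ?thesis by simp
qed

lemma shift_invariant:
  fixes u v :: int
  assumes "\<And>p. P p \<Longrightarrow> P (p + u)" "\<And>p. P p \<Longrightarrow> P (p - u)"
    "\<And>p. P p \<Longrightarrow> P (p + v)" "\<And>p. P p \<Longrightarrow> P (p - v)" "P p"
  shows "P (p + i * u + j * v)"
proof -
  have "P (p + i * u)"
    by (induction i rule: int_induct[where k = 0])
      (use assms(1,2)[of "p + i * u" for i] assms(5) in \<open>simp_all add: algebra_simps\<close>)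
  then show ?thesis
    by (induction j rule: int_induct[where k = 0])
      (use assms(3,4)[of "p + i * u + j * v" for j] in \<open>simp_all add: algebra_simps\<close>)
qed

text \<open>By Bezout, \<open>q - p\<close> is an integer combination of \<open>u\<close> and
  \<open>v\<close>. Used twice: to spread the orientation along \<open>k\<close> and
  \<open>t\<close>, and to spread a color along two coprime periods.\<close>

lemma shift_invariant_coprime:
  fixes u v :: int
  assumes "\<And>p. P p \<Longrightarrow> P (p + u)" "\<And>p. P p \<Longrightarrow> P (p - u)"
    "\<And>p. P p \<Longrightarrow> P (p + v)" "\<And>p. P p \<Longrightarrow> P (p - v)" "P p" "coprime u v"
  shows "P q"
proof -
  obtain x y where "x * u + y * v = 1"
    using bezout_int[of u v] assms(6) by auto
  then have "q = p + ((q - p) * x) * u + ((q - p) * y) * v"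
    by (metis add.assoc add_diff_cancel_left' diff_add_cancel distrib_left mult.assoc mult.right_neutral
        add.commute)
  then show ?thesis using shift_invariant[of P u v p, OF assms(1-5)] by metis
qed

text \<open>For a separated five-coloring exactly one of \<open>orient k t f p\<close> and
  \<open>orient t k f p\<close> holds, so the negation is the same situation with \<open>k\<close>
  and \<open>t\<close> exchanged.\<close>

definition orient :: "int \<Rightarrow> int \<Rightarrow> (int \<Rightarrow> 'a) \<Rightarrow> int \<Rightarrow> bool" where
  "orient k t f p \<longleftrightarrow> f (p + k + t) = f (p - k)"

context
  fixes k t :: int and f :: "int \<Rightarrow> nat"
  assumes sep: "separated k t f" and range: "range f \<subseteq> {1..5}"
begin

lemma star_cover: "f q \<in> {f p, f (p + k), f (p - k), f (p + t), f (p - t)}"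
proof -
  have "{f p, f (p + k), f (p - k), f (p + t), f (p - t)} = {1..5}"
    by (rule card_subset_eq) (use range card_star[OF sep] in \<open>auto simp: image_subset_iff\<close>)
  then show ?thesis using range by blast
qed

text \<open>Two of the five colors of the star at \<open>p\<close> are possible at each of the four diagonal
  neighbors of \<open>p\<close>, and the choice at one of them determines the other three.\<close>

lemma diagonal:
  shows "f (p + k + t) = f (p - k) \<or> f (p + k + t) = f (p - t)"
    and "f (p + k - t) = f (p - k) \<or> f (p + k - t) = f (p + t)"
    and "f (p - k + t) = f (p + k) \<or> f (p - k + t) = f (p - t)"
    and "f (p - k - t) = f (p + k) \<or> f (p - k - t) = f (p + t)"
  using star_cover[of "p + k + t" p] star_cover[of "p + k - t" p]
    star_cover[of "p - k + t" p] star_cover[of "p - k - t" p]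
    separatedD[OF sep, of "k + t" "p + k + t" p] separatedD[OF sep, of "k - t" "p + k - t" p]
    separatedD[OF sep, of "k - t" "p - k + t" p] separatedD[OF sep, of "k + t" "p - k - t" p]
    separatedD[OF sep, of t "p + k + t" "p + k"] separatedD[OF sep, of k "p + k + t" "p + t"]
    separatedD[OF sep, of t "p + k - t" "p + k"] separatedD[OF sep, of k "p + k - t" "p - t"]
    separatedD[OF sep, of t "p - k + t" "p - k"] separatedD[OF sep, of k "p - k + t" "p + t"]
    separatedD[OF sep, of t "p - k - t" "p - k"] separatedD[OF sep, of k "p - k - t" "p - t"]
  by auto

text \<open>Go round the four diagonal neighbors: consecutive ones differ by \<open>2*k\<close> or
  \<open>2*t\<close>, so the color used at one is excluded at the next, where only the other option
  of \<open>diagonal\<close> remains.\<close>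

lemma orientD:
  assumes "orient k t f p"
  shows "f (p + k + t) = f (p - k)" "f (p + k - t) = f (p + t)"
    "f (p - k - t) = f (p + k)" "f (p - k + t) = f (p - t)"
proof -
  show 1: "f (p + k + t) = f (p - k)" using assms by (simp add: orient_def)
  show 2: "f (p + k - t) = f (p + t)"
    using 1 diagonal(2)[of p] separatedD[OF sep, of "2*t" "p + k + t" "p + k - t"] by auto
  show 3: "f (p - k - t) = f (p + k)"
    using 2 diagonal(4)[of p] separatedD[OF sep, of "2*k" "p + k - t" "p - k - t"] by auto
  show 4: "f (p - k + t) = f (p - t)"
    using 3 diagonal(3)[of p] separatedD[OF sep, of "2*t" "p - k + t" "p - k - t"] by auto
qed

lemma not_orientD:
  assumes "\<not> orient k t f p"
  shows "f (p + k + t) = f (p - t)" "f (p - k + t) = f (p + k)"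
    "f (p - k - t) = f (p + t)" "f (p + k - t) = f (p - k)"
proof -
  show 1: "f (p + k + t) = f (p - t)" using assms diagonal(1)[of p] by (simp add: orient_def)
  show 2: "f (p - k + t) = f (p + k)"
    using 1 diagonal(3)[of p] separatedD[OF sep, of "2*k" "p + k + t" "p - k + t"] by auto
  show 3: "f (p - k - t) = f (p + t)"
    using 2 diagonal(4)[of p] separatedD[OF sep, of "2*t" "p - k + t" "p - k - t"] by auto
  show 4: "f (p + k - t) = f (p - k)"
    using 3 diagonal(2)[of p] separatedD[OF sep, of "2*k" "p + k - t" "p - k - t"] by auto
qed

text \<open>If a neighbor had the opposite orientation, a diagonal neighbor of \<open>p\<close>
  would share its color with two different vertices of the star at \<open>p\<close>, which are at a
  forbidden difference \<open>k - t\<close> or \<open>k + t\<close>.\<close>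

lemma orient_shift:
  assumes "orient k t f p"
  shows "orient k t f (p + k)" "orient k t f (p - k)" "orient k t f (p + t)" "orient k t f (p - t)"
proof -
  note A = orientD[OF assms] and s = separatedD[OF sep]
  show "orient k t f (p + k)"
    using A(1) not_orientD(3)[of "p + k"] s[of "k - t" "p - k" "p - t"]
    by (auto simp: algebra_simps abs_minus_commute[of t k])
  show "orient k t f (p - k)"
    using A(3) not_orientD(1)[of "p - k"] s[of "k - t" "p + k" "p + t"]
    by (auto simp: algebra_simps abs_minus_commute[of t k])
  show "orient k t f (p + t)"
    using A(4) not_orientD(4)[of "p + t"] s[of "k + t" "p + k" "p - t"] by (auto simp: algebra_simps)
  show "orient k t f (p - t)"
    using A(2) not_orientD(2)[of "p - t"] s[of "k + t" "p - k" "p + t"] by (auto simp: algebra_simps)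
qed

text \<open>If the periods \<open>2 * k + t\<close> and \<open>k - 2 * t\<close> are coprime, then \<open>f\<close> is constant.\<close>

lemma orient_imp_5_dvd:
  assumes "coprime k t" "orient k t f p"
  shows "5 dvd 2 * k + t"
proof (rule ccontr)
  assume n5: "\<not> 5 dvd 2 * k + t"
  have A: "orient k t f q" for q
    using shift_invariant_coprime[of "orient k t f" k t p q] orient_shift assms by blast
  \<comment> \<open>Both periods are orientation equations, read at \<open>q + k\<close> and at
    \<open>q - t\<close>.\<close>
  have P: "f (q + (2 * k + t)) = f q" and Q: "f (q + (k - 2 * t)) = f q" for q
    using orientD(1)[OF A[of "q + k"]] orientD(2)[OF A[of "q - t"]] by (simp_all add: algebra_simps)
  have "coprime (2 * k + t) (k - 2 * t)"
  proof (rule coprimeI)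
    fix d assume d: "d dvd 2 * k + t" "d dvd k - 2 * t"
    \<comment> \<open>Eliminating \<open>t\<close> and then \<open>k\<close> shows that a common
      divisor of the periods divides \<open>5 * k\<close> and \<open>5 * t\<close>, hence 5.\<close>
    have eqs: "5 * k = 2 * (2 * k + t) + (k - 2 * t)" "5 * t = (2 * k + t) - 2 * (k - 2 * t)"
      by simp_all
    have "d dvd 5 * k" unfolding eqs(1) by (intro dvd_add dvd_mult d)
    moreover have "d dvd 5 * t" unfolding eqs(2) by (intro dvd_diff dvd_mult d)
    ultimately have "d dvd gcd (5 * k) (5 * t)" by (rule gcd_greatest)
    then have d5: "d dvd 5" using assms(1) by (simp add: gcd_mult_left)
    then have "\<bar>d\<bar> \<le> 5" using zdvd_imp_le[of "\<bar>d\<bar>" 5] by simp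
    then have "d \<in> {-5, -4, -3, -2, -1, 0, 1, 2, 3, 4, 5}" by (simp; presburger)
    \<comment> \<open>Of the listed values only 1, -1, 5 and -5 divide 5, and \<open>n5\<close>
      excludes the last two.\<close>
    then show "is_unit d" using n5 d(1) d5 by auto
  qed
  then have "f (p + k) = f p"
    using shift_invariant_coprime[of "\<lambda>q. f q = f p" "2 * k + t" "k - 2 * t" p "p + k"]
      P Q P[of "q - (2 * k + t)" for q] Q[of "q - (k - 2 * t)" for q] by (simp del: add_diff_eq)
  then show False using separatedD[OF sep, of k "p + k" p] by simp
qed

end

lemma five_coloring_imp_dvd:
  fixes f :: "int \<Rightarrow> nat"
  assumes "separated k t f" "range f \<subseteq> {1..5}" "coprime k t"
  shows "5 dvd 2 * k + t \<or> 5 dvd 2 * t + k"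
proof (cases "orient k t f 0")
  case True
  then show ?thesis using orient_imp_5_dvd[OF assms] by blast
next
  case False
  have sep: "separated t k f" using assms(1) separated_commute by blast
  have "orient t k f 0"
    using not_orientD(1)[OF assms(1,2) False] by (simp add: orient_def add.commute)
  moreover have "coprime t k" using assms(3) by (simp add: coprime_commute)
  ultimately show ?thesis using orient_imp_5_dvd[OF sep assms(2)] by blast
qed

section \<open>Colorings by residues\<close>

lemma mod_coloring:
  assumes "\<forall>d\<in>{k, t, 2*k, 2*t, k + t, k - t}. \<not> m dvd d"
  shows "separated k t (\<lambda>x. x mod m)"
  unfolding separated_def using assms by (metis add_diff_cancel_left' mod_eq_dvd_iff)

text \<open>If \<open>t\<close> is \<open>-2 * k\<close> modulo 5, the six differences are
  \<open>k\<close> times 1, -2, 2, -4, -1, 3, and 5 cannot divide \<open>k\<close> without dividing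
  \<open>t\<close>. The other case is symmetric.\<close>

lemma not_5_dvd_differences:
  fixes k t :: int
  assumes "5 dvd 2 * k + t \<or> 5 dvd 2 * t + k" "coprime k t"
  shows "\<forall>d\<in>{k, t, 2*k, 2*t, k + t, k - t}. \<not> 5 dvd d"
proof -
  have "\<not> (5 dvd k \<and> 5 dvd t)"
    using assms(2) by (auto dest: coprime_common_divisor)
  then show ?thesis using assms(1) by (simp; presburger)
qed

section \<open>Six-colorings from cyclic block words\<close>

text \<open>The \<open>a\<close> blocks of length 5 come first; the number of blocks of length 6 is
  set only by the length \<open>N\<close> at which the word is closed up.\<close>

definition block_word :: "int \<Rightarrow> int \<Rightarrow> int" where
  "block_word a i = (if i < 5 * a then i mod 5 else (i - 5 * a) mod 6)"

lemma block_word_range: "block_word a i \<in> {0..<6}"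
proof -
  have "0 \<le> i mod 5" "i mod 5 < 5" "0 \<le> (i - 5 * a) mod 6" "(i - 5 * a) mod 6 < 6"
    by simp_all
  then show ?thesis unfolding block_word_def by (simp; linarith)
qed

lemma mod_add_neq:
  fixes i d m :: int
  assumes "0 < d" "d < m"
  shows "(i + d) mod m \<noteq> i mod m"
  using assms zdvd_not_zless[of d m] by (simp add: mod_eq_dvd_iff)

lemma mult_diff_mod:
  fixes a j m :: int
  assumes "0 < j" "j \<le> m"
  shows "(m * a - j) mod m = m - j"
proof -
  have "m * a - j = (m - j) + m * (a - 1)" by (simp add: algebra_simps)
  then have "(m * a - j) mod m = (m - j) mod m" by (metis mod_mult_self2)
  also have "\<dots> = m - j" using assms by (intro mod_pos_pos_trivial) auto
  finally show ?thesis .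
qed

text \<open>Within a run of equal blocks the letters are residues modulo 5 or 6, and
  \<open>d\<close> is smaller than both. Where the block length may change, a letter
  \<open>j\<close> places before the boundary is \<open>5 - j\<close> or \<open>6 - j\<close>, while
  the one \<open>d - j\<close> places after it is \<open>d - j\<close>, which is smaller.\<close>

lemma block_word_cyclic:
  fixes a b i d N :: int
  assumes "0 \<le> a" "0 \<le> b" "0 < a + b" and N: "N = 5 * a + 6 * b"
    and i: "0 \<le> i" "i < N" and d: "1 \<le> d" "d \<le> 4"
  shows "block_word a ((i + d) mod N) \<noteq> block_word a i"
proof (cases "i + d < N")
  case True
  have ne5: "(i + d) mod 5 \<noteq> i mod 5" using d by (intro mod_add_neq) auto
  have ne6: "(i + d - 5 * a) mod 6 \<noteq> (i - 5 * a) mod 6"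
    using d mod_add_neq[of d 6 "i - 5 * a"] by (simp add: algebra_simps)
  \<comment> \<open>The passage from the blocks of length 5 to those of length 6, with
    \<open>j\<close> the distance from \<open>i\<close> to the boundary.\<close>
  have "(i + d - 5 * a) mod 6 \<noteq> i mod 5" if "i < 5 * a" "5 * a \<le> i + d"
  proof -
    define j where "j = 5 * a - i"
    have "1 \<le> j" "j \<le> d" using that j_def by auto
    moreover have "i = 5 * a - j" using j_def by simp
    moreover have "(5 * a - j) mod 5 = 5 - j"
      using d \<open>1 \<le> j\<close> \<open>j \<le> d\<close> by (intro mult_diff_mod) auto
    ultimately show ?thesis using d by simp
  qed
  with ne5 ne6 d have "block_word a (i + d) \<noteq> block_word a i"
    unfolding block_word_def by auto
  then show ?thesis using True i d by simp
next
  case False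
  define j where "j = N - i"
  have j: "1 \<le> j" "j \<le> d" "i = N - j" using False i j_def by auto
  have "i + d = (d - j) + N" using j by simp
  then have "(i + d) mod N = (d - j) mod N" by (metis mod_add_self2)
  also have "\<dots> = d - j" using j d assms(1-3) N by (intro mod_pos_pos_trivial) auto
  finally have "(i + d) mod N = d - j" .
  moreover have "block_word a (d - j) = d - j"
    unfolding block_word_def using j d assms(1) by auto
  moreover have "block_word a i \<noteq> d - j"
  \<comment> \<open>The last block before the wrap-around has length 5 exactly when
    \<open>b = 0\<close>.\<close>
  proof (cases "b = 0")
    case True
    then have "block_word a i = (5 * a - j) mod 5"
      unfolding block_word_def using j N by simp
    also have "\<dots> = 5 - j" using j d by (intro mult_diff_mod) auto
    finally show ?thesis using d by simp
  next
    case False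
    then have "block_word a i = (6 * b - j) mod 6"
      unfolding block_word_def using j d N assms(2) by simp
    also have "\<dots> = 6 - j" using j d by (intro mult_diff_mod) auto
    finally show ?thesis using d by simp
  qed
  ultimately show ?thesis by simp
qed

text \<open>Multiplication by \<open>c\<close> with \<open>c * t = - 1\<close> modulo \<open>N = 2 * t + k\<close> sends the differences
  \<open>k, t, 2 * k, 2 * t, k + t, k - t\<close> to \<open>2, - 1, 4, - 2, 1, 3\<close>.\<close>

lemma block_coloring:
  fixes k t a b :: int
  assumes "coprime k t" "0 \<le> a" "0 \<le> b" "0 < a + b" "2 * t + k = 5 * a + 6 * b"
  shows "\<exists>f::int \<Rightarrow> int. range f \<subseteq> {0..<6} \<and> separated k t f"
proof -
  define N where "N = 5 * a + 6 * b"
  have Npos: "0 < N" using assms N_def by linarith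
  have k: "k = N - 2 * t" using assms(5) N_def by linarith
  \<comment> \<open>Coprimality of \<open>k\<close> and \<open>t\<close> makes \<open>t\<close>
    invertible modulo \<open>N\<close>, with inverse \<open>x\<close>.\<close>
  have "gcd t N = gcd t k" using assms(5) N_def gcd_add_mult[of t 2 k] by simp
  then obtain x y where xy: "x * t + y * N = 1"
    using bezout_int[of t N] assms(1) by (auto simp: coprime_iff_gcd_eq_1 gcd.commute)
  define c where "c = - x"
  define f where "f p = block_word a ((c * p) mod N)" for p
  have ct: "c * t = - 1 + N * y" using xy by (simp add: c_def algebra_simps)
  have ck: "c * k = 2 + N * (c - 2 * y)" using ct by (simp add: k algebra_simps)
  have pos: "f (p + d) \<noteq> f p" if "c * d = e + N * z" "1 \<le> e" "e \<le> 4" for p d e z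
  proof -
    have "c * (p + d) = c * p + e + N * z" using that(1) by (simp add: algebra_simps)
    then have "(c * (p + d)) mod N = (c * p mod N + e) mod N" by (simp add: mod_simps)
    then show ?thesis
      using block_word_cyclic[OF assms(2-4) N_def _ _ that(2,3)] Npos by (simp add: f_def)
  qed
  have neg: "f (p + d) \<noteq> f p" if "c * d = - e + N * z" "1 \<le> e" "e \<le> 4" for p d e z
    using pos[of "- d" e "- z" "p + d"] that by simp
  have "separated k t f"
    unfolding separated_def
  proof (intro allI ballI)
    fix p d assume "d \<in> {k, t, 2*k, 2*t, k + t, k - t}"
    then consider "d = k" | "d = t" | "d = 2*k" | "d = 2*t" | "d = k + t" | "d = k - t" by blast
    then show "f (p + d) \<noteq> f p"
    proof cases
      case 1 then show ?thesis using pos ck by auto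
    next
      case 2 then show ?thesis using neg ct by auto
    next
      case 3
      then have "c * d = 4 + N * (2 * (c - 2 * y))" using ck by (simp add: algebra_simps)
      then show ?thesis using pos by auto
    next
      case 4
      then have "c * d = - 2 + N * (2 * y)" using ct by (simp add: algebra_simps)
      then show ?thesis using neg by auto
    next
      case 5
      then have "c * d = 1 + N * (c - y)" using ct ck by (simp add: algebra_simps)
      then show ?thesis using pos by auto
    next
      case 6
      then have "c * d = 3 + N * (c - 3 * y)" using ct ck unfolding 6 by (simp add: algebra_simps)
      then show ?thesis using pos by auto
    qed
  qed
  moreover have "range f \<subseteq> {0..<6}" using block_word_range by (auto simp: f_def)
  ultimately show ?thesis by blast
qed

text \<open>As 6 is 1 modulo 5, taking the residue modulo 5 as the number of blocks of length 6
  leaves a multiple of 5, nonnegative by the last hypothesis.\<close>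

lemma large_block_coloring:
  fixes k t :: int
  assumes "coprime k t" "0 < 2 * t + k" "6 * ((2 * t + k) mod 5) \<le> 2 * t + k"
  shows "\<exists>f::int \<Rightarrow> int. range f \<subseteq> {0..<6} \<and> separated k t f"
proof -
  define N where "N = 2 * t + k"
  have "5 dvd N - 6 * (N mod 5)" by presburger
  then obtain a where a: "N - 6 * (N mod 5) = 5 * a" by blast
  have "0 \<le> a" "0 \<le> N mod 5" using a assms(3) N_def by auto
  moreover have "0 < a + N mod 5" using a assms(2) \<open>0 \<le> a\<close> \<open>0 \<le> N mod 5\<close> N_def by linarith
  moreover have "2 * t + k = 5 * a + 6 * (N mod 5)" using a N_def by linarith
  ultimately show ?thesis by (rule block_coloring[OF assms(1)])
qed

lemma six_coloring_exists:
  fixes k t :: int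
  assumes "coprime k t" "3 \<le> k" "k < t"
  shows "\<exists>f::int \<Rightarrow> int. range f \<subseteq> {0..<6} \<and> separated k t f"
proof -
  consider "6 * ((2 * t + k) mod 5) \<le> 2 * t + k" | "6 * ((2 * k + t) mod 5) \<le> 2 * k + t"
    | "k = 4" "t = 5" | "k = 3" "t = 8"
  proof -
    have "6 * ((2 * t + k) mod 5) \<le> 2 * t + k \<or> 6 * ((2 * k + t) mod 5) \<le> 2 * k + t
        \<or> (k = 4 \<and> t = 5) \<or> (k = 3 \<and> t = 8)"
    proof (cases "t \<le> 8")
      case True
      then have "t \<in> {4, 5, 6, 7, 8}" "k \<in> {3, 4, 5, 6, 7}" using assms by auto
      then show ?thesis using assms by auto
    next
      case False
      \<comment> \<open>The left side exceeds 18 only for residue 4, where it is 24 and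
        \<open>n\<close> is already at least 24. The bound 21 is \<open>2 * 9 + 3\<close>, which
        explains the split at \<open>t \<le> 8\<close>.\<close>
      have "6 * (n mod 5) \<le> n" if "21 \<le> n" for n :: int using that by presburger
      moreover have "21 \<le> 2 * t + k" using False assms by linarith
      ultimately show ?thesis by blast
    qed
    then show thesis using that by blast
  qed
  then show ?thesis
  proof cases
    case 1
    then show ?thesis using large_block_coloring assms by auto
  next
    case 2
    then have "\<exists>f::int \<Rightarrow> int. range f \<subseteq> {0..<6} \<and> separated t k f"
      using large_block_coloring[of t k] assms by (simp add: coprime_commute)
    then show ?thesis by (simp add: separated_commute)
  next
    case 3
    have "separated k t (\<lambda>x. x mod 6)"
      by (rule mod_coloring) (use 3 in simp)
    then show ?thesis by (intro exI[of _ "\<lambda>x. x mod 6"]) auto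
  next
    case 4
    \<comment> \<open>The pattern is 0101 2323 4545. Up to sign, the forbidden differences modulo 12
      are 1, 3, 4, 5, 6, so the pairs \<open>r\<close>, \<open>r + 2\<close> can serve as color
      classes.\<close>
    define g :: "int \<Rightarrow> int" where "g r = 2 * (r div 4) + r mod 2" for r
    define f where "f x = g (x mod 12)" for x
    have r: "x mod 12 \<in> {0, 1, 2, 3, 4, 5, 6, 7, 8, 9, 10, 11}" for x :: int
      using pos_mod_bound[of 12 x] pos_mod_sign[of 12 x] by (simp del: pos_mod_bound pos_mod_sign; arith)
    have ne: "\<forall>r\<in>{0, 1, 2, 3, 4, 5, 6, 7, 8, 9, 10, 11}. \<forall>d\<in>{3, 8, 6, 16, 11, - 5}.
        g ((r + d) mod 12) \<noteq> g r"
      by (simp add: g_def)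
    have "f (p + d) \<noteq> f p" if "d \<in> {3, 8, 6, 16, 11, - 5}" for p d
    proof -
      have "g ((p mod 12 + d) mod 12) \<noteq> g (p mod 12)"
        by (rule ne[THEN bspec, THEN bspec, OF r that])
      then show ?thesis by (simp add: f_def mod_add_left_eq)
    qed
    then have "separated k t f" using 4 by (simp add: separated_def)
    moreover have "\<forall>r\<in>{0, 1, 2, 3, 4, 5, 6, 7, 8, 9, 10, 11}. g r \<in> {0..<6}"
      by (simp add: g_def)
    then have "range f \<subseteq> {0..<6}" using bspec[OF _ r] unfolding f_def by (intro image_subsetI)
    ultimately show ?thesis by blast
  qed
qed

section \<open>From separated colorings to the packing chromatic number\<close>

lemma packing_coloringI:
  fixes f :: "int \<Rightarrow> int"
  assumes "0 < k" "k < t" "separated (int k) (int t) f" "range f \<subseteq> {0..<int l}"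
  shows "packing_coloring S2 l (G k t) (\<lambda>x. nat (f x) + 1)"
proof -
  have r: "0 \<le> f x \<and> f x < int l" for x using assms(4) by (auto simp: image_subset_iff)
  then have "nat (f x) + 1 = nat (f y) + 1 \<longleftrightarrow> f x = f y" for x y by (simp add: eq_nat_nat_iff)
  then have "separated (int k) (int t) (\<lambda>x. nat (f x) + 1)"
    using assms(3) unfolding separated_def by presburger
  moreover have "nat (f x) + 1 \<in> {1..l}" for x using r[of x] by simp linarith
  ultimately show ?thesis using packing_coloring_S2_G_iff[OF assms(1,2)] by blast
qed

lemma packing_chromatic_number_eqI:
  assumes "packing_coloring S l E f" "1 \<le> l"
    "\<And>m g. packing_coloring S m E g \<Longrightarrow> l \<le> m"
  shows "packing_chromatic_number S E = enat l"
  unfolding packing_chromatic_number_def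
proof (rule antisym)
  show "Inf {enat l | l. 1 \<le> l \<and> (\<exists>f. packing_coloring S l E f)} \<le> enat l"
    by (rule Inf_lower) (use assms in blast)
  show "enat l \<le> Inf {enat l | l. 1 \<le> l \<and> (\<exists>f. packing_coloring S l E f)}"
    by (rule Inf_greatest) (use assms(3) in fastforce)
qed

lemma five_le_packing_colors:
  assumes "0 < k" "k < t" "packing_coloring S2 l (G k t) f"
  shows "5 \<le> l"
proof -
  have f: "range f \<subseteq> {1..l}" "separated (int k) (int t) f"
    using assms packing_coloring_S2_G_iff by blast+
  have "card {f 0, f (0 + int k), f (0 - int k), f (0 + int t), f (0 - int t)} \<le> card {1..l}"
    by (rule card_mono) (use f(1) in \<open>auto simp only: finite_atLeastAtMost\<close>)
  then show ?thesis unfolding card_star[OF f(2)] by simp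
qed

theorem theorem3p4:
  fixes k t :: nat
  assumes "coprime k t" and "3 \<le> k" and "k < t"
  shows
    "((t mod 5 \<in> {1, 4} \<and> k mod 5 \<in> {2, 3}) \<or> (t mod 5 \<in> {2, 3} \<and> k mod 5 \<in> {1, 4})
        \<longrightarrow> packing_chromatic_number S2 (G k t) = 5) \<and>
     (\<not> ((t mod 5 \<in> {1, 4} \<and> k mod 5 \<in> {2, 3}) \<or> (t mod 5 \<in> {2, 3} \<and> k mod 5 \<in> {1, 4}))
        \<longrightarrow> packing_chromatic_number S2 (G k t) = 6)"
proof -
  have k: "0 < k" using assms(2) by simp
  have cop: "coprime (int k) (int t)" using assms(1) by simp
  \<comment> \<open>If 5 divided both numbers, the divisibility condition would hold but the residue
    condition would fail; in all other cases the two agree.\<close>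
  have "\<not> (5 dvd k \<and> 5 dvd t)" using assms(1) by (auto dest: coprime_common_divisor)
  then have "(t mod 5 \<in> {1, 4} \<and> k mod 5 \<in> {2, 3}) \<or> (t mod 5 \<in> {2, 3} \<and> k mod 5 \<in> {1, 4})
      \<longleftrightarrow> 5 dvd 2 * k + t \<or> 5 dvd 2 * t + k"
    by (simp; presburger)
  also have "\<dots> \<longleftrightarrow> 5 dvd 2 * int k + int t \<or> 5 dvd 2 * int t + int k" (is "_ \<longleftrightarrow> ?C")
    by presburger
  finally have cond: "(t mod 5 \<in> {1, 4} \<and> k mod 5 \<in> {2, 3}) \<or> (t mod 5 \<in> {2, 3} \<and> k mod 5 \<in> {1, 4})
      \<longleftrightarrow> ?C" .
  have five: "packing_chromatic_number S2 (G k t) = 5" if ?C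
  proof -
    have "packing_coloring S2 5 (G k t) (\<lambda>x. nat (x mod 5) + 1)"
      by (rule packing_coloringI[OF k assms(3) mod_coloring[OF not_5_dvd_differences[OF that cop]]])
        auto
    then show ?thesis
      using packing_chromatic_number_eqI[of S2 5 "G k t"] five_le_packing_colors[OF k assms(3)]
      by (simp add: numeral_eq_enat)
  qed
  have six: "packing_chromatic_number S2 (G k t) = 6" if "\<not> ?C"
  proof -
    obtain f :: "int \<Rightarrow> int" where "range f \<subseteq> {0..<6}" "separated (int k) (int t) f"
      using six_coloring_exists[OF cop] assms(2,3) by auto
    then have "packing_coloring S2 6 (G k t) (\<lambda>x. nat (f x) + 1)"
      using packing_coloringI[OF k assms(3), of f 6] by simp
    moreover have "6 \<le> m" if g: "packing_coloring S2 m (G k t) g" for m g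
    proof (rule ccontr)
      assume "\<not> 6 \<le> m"
      then have "m = 5" using five_le_packing_colors[OF k assms(3) g] by simp
      then show False
        using g five_coloring_imp_dvd[OF _ _ cop] packing_coloring_S2_G_iff[OF k assms(3)] \<open>\<not> ?C\<close>
        by blast
    qed
    ultimately show ?thesis
      using packing_chromatic_number_eqI[of S2 6 "G k t"] by (simp add: numeral_eq_enat)
  qed
  show ?thesis using cond five six by presburger
qed

end
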